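(* For every $t\ge 0$ and every $0<\beta<1$ there exists a constant $\lambda>0$ (not depending on $n$) such that for every $n\in\mathbb{Z}_{>0}$ $$\mathbb{E}_{\mathbf h^t}\left[\left\langle e^{\lambda n\left(R_{\sigma,\tau}-q^*\right)^2}\right\rangle_{\mathbf h^t}\right]\le 2,$$ where $R_{\sigma,\tau}=\frac1n\sum_{i=1}^n\sigma_i\tau_i$, $\langle\cdot\rangle_{\mathbf h^t}$ denotes the average over two independent samples $\sigma,\tau$ from the Gibbs measure of the Curie--Weiss random field model given $\mathbf h^t$, and $\mathbb{E}_{\mathbf h^t}$ is the expectation over $\mathbf h^t\sim\mathcal N(t\mathbf 1_n,(\beta^2q^*+t)I_n)$.
   Context: Fix $t\ge0$ and $\beta>0$. The pair $(m^*,q^* )$ denotes a solution of the fixed-point equations $$m^*=\mathbb{E}_{g\sim\mathcal N(0,1)}\left[\tanh\left(\beta^2m^*+t+\sqrt{\beta^2q^*+t}\,g\right)\right],\qquad q^*=\mathbb{E}_{g\sim\mathcal N(0,1)}\left[\tanh^2\left(\beta^2m^*+t+\sqrt{\beta^2q^*+t}\,g\right)\right];$$ such a solution is known to exist. The random field is $\mathbf h^t=(h^t_1,\dots,h^t_n)$ with $h_i^t$ i.i.d. $\mathcal N(t,\beta^2q^*+t)$. For $\mathbf h=(h_1,\dots,h_n)\in\mathbb{R}^n$ the Gibbs measure on $\{-1,+1\}^n$ is $$\mu_{n,\mathbf h}(\sigma)=\frac1{Z_n(\mathbf h)}\exp\left\{\frac{\beta^2}{2n}\Big(\sum_{i=1}^n\sigma_i\Big)^2+\sum_{i=1}^nh_i\sigma_i\right\},$$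 with $Z_n(\mathbf h)$ the normalizing constant, and for $f:(\{-1,+1\}^n)^2\to\mathbb{R}$, $\langle f\rangle_{\mathbf h}=\sum_{\sigma,\tau}f(\sigma,\tau)\mu_{n,\mathbf h}(\sigma)\mu_{n,\mathbf h}(\tau)$. *)

theory Defs
  imports "HOL-Probability.Probability"
begin

(* The normal distribution with given mean and variance. It is defined as an affine image of the
   standard one, because the variance may vanish here (t = 0 with q = 0), in which case the
   distribution is a point mass and has no density. *)
definition normal_dist :: "real \<Rightarrow> real \<Rightarrow> real measure" where
  "normal_dist \<mu> v = distr std_normal_distribution borel (\<lambda>g. \<mu> + sqrt v * g)"

lemma normal_dist_eq_density:
  assumes "v > 0"
  shows "normal_dist \<mu> v = density lborel (normal_density \<mu> (sqrt v))"
proof -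
  interpret N: prob_space std_normal_distribution
    by (rule prob_space_normal_density) simp
  have "distributed std_normal_distribution lborel (\<lambda>g. g) std_normal_density"
    unfolding distributed_def by (auto simp: distr_id2)
  from N.normal_density_affine[OF this, of "sqrt v" \<mu>] assms
  have "distributed std_normal_distribution lborel (\<lambda>g. \<mu> + sqrt v * g)
          (normal_density \<mu> (sqrt v))"
    by simp
  from distributed_distr_eq_density[OF this] show ?thesis
    unfolding normal_dist_def by (metis distr_cong sets_lborel)
qed

lemma normal_dist_zero: "normal_dist \<mu> 0 = return borel \<mu>"
proof -
  interpret N: prob_space std_normal_distribution
    by (rule prob_space_normal_density) simp
  show ?thesis
    unfolding normal_dist_def by (simp add: N.distr_const)
qed

definition fixed_point :: "real \<Rightarrow> real \<Rightarrow> real \<Rightarrow> real \<Rightarrow> bool" where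
  "fixed_point \<beta> t m q \<longleftrightarrow>
     m = (\<integral>g. tanh (\<beta>\<^sup>2 * m + t + sqrt (\<beta>\<^sup>2 * q + t) * g) \<partial>std_normal_distribution) \<and>
     q = (\<integral>g. (tanh (\<beta>\<^sup>2 * m + t + sqrt (\<beta>\<^sup>2 * q + t) * g))\<^sup>2 \<partial>std_normal_distribution)"

(* Vectors of length n are functions on the index set {1..n}, extended by undefined outside it. *)
definition field_dist :: "nat \<Rightarrow> real \<Rightarrow> real \<Rightarrow> real \<Rightarrow> (nat \<Rightarrow> real) measure" where
  "field_dist n \<beta> t q = Pi\<^sub>M {1..n} (\<lambda>_. normal_dist t (\<beta>\<^sup>2 * q + t))"

definition spins :: "nat \<Rightarrow> (nat \<Rightarrow> real) set" where
  "spins n = ({1..n} \<rightarrow>\<^sub>E {-1, 1})"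

definition gibbs_weight :: "nat \<Rightarrow> real \<Rightarrow> (nat \<Rightarrow> real) \<Rightarrow> (nat \<Rightarrow> real) \<Rightarrow> real" where
  "gibbs_weight n \<beta> h \<sigma> =
     exp (\<beta>\<^sup>2 / (2 * real n) * (\<Sum>i=1..n. \<sigma> i)\<^sup>2 + (\<Sum>i=1..n. h i * \<sigma> i))"

definition partition_fun :: "nat \<Rightarrow> real \<Rightarrow> (nat \<Rightarrow> real) \<Rightarrow> real" where
  "partition_fun n \<beta> h = (\<Sum>\<sigma>\<in>spins n. gibbs_weight n \<beta> h \<sigma>)"

definition gibbs :: "nat \<Rightarrow> real \<Rightarrow> (nat \<Rightarrow> real) \<Rightarrow> (nat \<Rightarrow> real) \<Rightarrow> real" where
  "gibbs n \<beta> h \<sigma> = gibbs_weight n \<beta> h \<sigma> / partition_fun n \<beta> h"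

definition gibbs_avg ::
    "nat \<Rightarrow> real \<Rightarrow> (nat \<Rightarrow> real) \<Rightarrow> ((nat \<Rightarrow> real) \<Rightarrow> (nat \<Rightarrow> real) \<Rightarrow> real) \<Rightarrow> real" where
  "gibbs_avg n \<beta> h f = (\<Sum>\<sigma>\<in>spins n. \<Sum>\<tau>\<in>spins n. f \<sigma> \<tau> * gibbs n \<beta> h \<sigma> * gibbs n \<beta> h \<tau>)"

definition overlap :: "nat \<Rightarrow> (nat \<Rightarrow> real) \<Rightarrow> (nat \<Rightarrow> real) \<Rightarrow> real" where
  "overlap n \<sigma> \<tau> = (\<Sum>i=1..n. \<sigma> i * \<tau> i) / real n"

lemma sum_gibbs: "(\<Sum>\<sigma>\<in>spins n. gibbs n \<beta> h \<sigma>) = 1"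
proof -
  have "finite (spins n)" "spins n \<noteq> {}"
    by (auto simp: spins_def PiE_eq_empty_iff intro: finite_PiE)
  then have "partition_fun n \<beta> h > 0"
    unfolding partition_fun_def by (intro sum_pos) (auto simp: gibbs_weight_def)
  then show ?thesis
    unfolding gibbs_def by (simp add: sum_divide_distrib [symmetric] partition_fun_def)
qed

end

theory Submission
  imports Defs
begin

text \<open>
  Write \<open>b = \<beta>\<^sup>2\<close>. Each \<open>h\<^sub>i\<close> is distributed as \<open>t + sqrt (b * q + t) * g\<close>, so the first fixed-point
  equation says that \<open>m\<close> is the mean of \<open>tanh (b * m + h\<^sub>i)\<close> and the second that \<open>q\<close> is the mean of its square.
  The proof freezes the field \<open>h\<close> first, compares the Gibbs measure with a product measure, and
  averages over \<open>h\<close> only at the end.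

  For a frozen \<open>h\<close> let \<open>x\<close> solve the empirical equation \<open>x = (1/n) \<Sum> tanh (b * x + h\<^sub>i)\<close>
  (\<open>ex_mean_field_solution\<close>) and let \<open>P\<close> be the law of independent spins with means
  \<open>p\<^sub>i = tanh (b * x + h\<^sub>i)\<close>. Completing the square in the Hamiltonian around \<open>n * x = \<Sum> p\<^sub>i\<close> shows that
  the Gibbs measure has a density with respect to \<open>P\<close> that is proportional to
  \<open>exp (b * A\<^sup>2 / (2 n))\<close>, where \<open>A = \<Sum> (\<sigma>\<^sub>i - p\<^sub>i)\<close> is centred. This density is at least \<open>1\<close>, so its
  normalization can simply be dropped from an upper bound (\<open>gibbs_le_spin_law\<close>). Centring at the
  empirical \<open>x\<close> and not at \<open>m\<close> is what makes the argument reach every \<open>b < 1\<close>: a linear term left in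
  the exponent would cost a factor whose average over \<open>h\<close> may grow with \<open>n\<close> for \<open>b\<close> close to \<open>1\<close>.

  A sum of \<open>n\<close> independent centred variables with values in intervals of length \<open>2\<close> is subgaussian with
  variance proxy \<open>n\<close> by Hoeffding's lemma, so \<open>exp (a * A\<^sup>2 / (2 n))\<close> has mean at most \<open>1 / sqrt (1 - a)\<close>
  for \<open>a < 1\<close> (\<open>subgaussian_exp_square\<close>). As \<open>b < 1\<close>, the Gibbs density is integrable with room to
  spare, and the room is spent on the overlap, which is split into two sums of centred spins (\<open>B\<close> and
  \<open>G\<close>) and two terms that depend on \<open>h\<close> alone (\<open>two_replica_bound\<close>, \<open>overlap_bound_given_field\<close>):
  \<open>n * (R - q) = B + G + \<Sum> (p\<^sub>i\<^sup>2 - tanh\<^sup>2 (b * m + h\<^sub>i)) + (\<Sum> tanh\<^sup>2 (b * m + h\<^sub>i) - n * q)\<close>.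
  The first field term is of order \<open>n * \<bar>x - m\<bar>\<close>. Since \<open>x \<mapsto> (1/n) \<Sum> tanh (b * x + h\<^sub>i)\<close> is a contraction with
  constant \<open>b\<close>, this is controlled by the fluctuation of \<open>(1/n) \<Sum> tanh (b * m + h\<^sub>i)\<close> around its mean \<open>m\<close>.
  Both fluctuations are sums of bounded i.i.d. variables, and the same subgaussian estimate applies
  (\<open>iid_mean_exp_square\<close>).

  All this gives a bound \<open>C\<close>, not \<open>2\<close>. Convexity turns \<open>C\<close> into \<open>2\<close> at the price of a smaller exponent:
  \<open>exp (\<theta> * X) \<le> 1 + \<theta> * exp X\<close>, with \<open>\<theta> = 1 / C\<close>.
\<close>

section \<open>Exponential moments of squares\<close>

lemma std_normal_exp_linear:
  "(\<integral>\<^sup>+z. ennreal (exp (s * z)) \<partial>std_normal_distribution) = ennreal (exp (s\<^sup>2 / 2))"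
proof -
  have "(\<integral>\<^sup>+z. ennreal (exp (s * z)) \<partial>std_normal_distribution)
      = (\<integral>\<^sup>+z. ennreal (std_normal_density z) * ennreal (exp (s * z)) \<partial>lborel)"
    by (subst nn_integral_density) auto
  also have "\<dots> = (\<integral>\<^sup>+z. ennreal (exp (s\<^sup>2 / 2)) * ennreal (normal_density s 1 z) \<partial>lborel)"
  proof (intro nn_integral_cong)
    fix z :: real
    have "- z\<^sup>2 / 2 + s * z = s\<^sup>2 / 2 + - (z - s)\<^sup>2 / 2"
      by (simp add: power2_eq_square field_simps)
    then have "std_normal_density z * exp (s * z) = exp (s\<^sup>2 / 2) * normal_density s 1 z"
      by (simp add: normal_density_def mult_exp_exp)
    then show "ennreal (std_normal_density z) * ennreal (exp (s * z))
        = ennreal (exp (s\<^sup>2 / 2)) * ennreal (normal_density s 1 z)"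
      by (simp add: ennreal_mult'[symmetric])
  qed
  also have "\<dots> = ennreal (exp (s\<^sup>2 / 2))"
    by (subst nn_integral_cmult) (auto simp: nn_integral_eq_integral)
  finally show ?thesis .
qed

lemma std_normal_exp_square:
  assumes "c < 1"
  shows "(\<integral>\<^sup>+z. ennreal (exp (c * z\<^sup>2 / 2)) \<partial>std_normal_distribution) = ennreal (1 / sqrt (1 - c))"
proof -
  define r where "r = 1 / sqrt (1 - c)"
  have r: "r > 0" "r\<^sup>2 = 1 / (1 - c)"
    using assms by (auto simp: r_def power_divide)
  have "(\<integral>\<^sup>+z. ennreal (exp (c * z\<^sup>2 / 2)) \<partial>std_normal_distribution)
      = (\<integral>\<^sup>+z. ennreal (std_normal_density z) * ennreal (exp (c * z\<^sup>2 / 2)) \<partial>lborel)"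
    by (subst nn_integral_density) auto
  also have "\<dots> = (\<integral>\<^sup>+z. ennreal r * ennreal (normal_density 0 r z) \<partial>lborel)"
  proof (intro nn_integral_cong)
    fix z :: real
    have "sqrt (2 * pi * r\<^sup>2) = sqrt (2 * pi) * r"
      using r(1) by (simp add: real_sqrt_mult)
    then have "r * normal_density 0 r z = 1 / sqrt (2 * pi) * exp (- z\<^sup>2 / (2 * r\<^sup>2))"
      using r(1) by (simp add: normal_density_def)
    also have "- z\<^sup>2 / (2 * r\<^sup>2) = - z\<^sup>2 / 2 + c * z\<^sup>2 / 2"
      by (simp add: r(2) field_simps)
    finally have "std_normal_density z * exp (c * z\<^sup>2 / 2) = r * normal_density 0 r z"
      by (simp add: std_normal_density_def mult_exp_exp)
    then show "ennreal (std_normal_density z) * ennreal (exp (c * z\<^sup>2 / 2))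
        = ennreal r * ennreal (normal_density 0 r z)"
      using r(1) by (simp add: ennreal_mult'[symmetric])
  qed
  also have "\<dots> = ennreal r"
    by (subst nn_integral_cmult) (auto simp: nn_integral_eq_integral r(1))
  finally show ?thesis by (simp add: r_def)
qed

text \<open>
  A square in an exponent is linearized by a standard Gaussian \<open>z\<close> independent of \<open>X\<close>:
  \<open>exp (a * X\<^sup>2 / 2)\<close> is the mean of \<open>exp (sqrt a * X * z)\<close>. After exchanging the integrals the hypothesis on
  the exponential moments of \<open>X\<close> applies for each \<open>z\<close>, and a Gaussian integral remains.
\<close>
lemma subgaussian_exp_square:
  fixes X :: "'a \<Rightarrow> real"
  assumes M: "sigma_finite_measure M" and X [measurable]: "X \<in> borel_measurable M"
    and mgf: "\<And>s. (\<integral>\<^sup>+x. ennreal (exp (s * X x)) \<partial>M) \<le> ennreal (exp (v * s\<^sup>2 / 2))"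
    and a: "0 \<le> a" "a * v < 1"
  shows "(\<integral>\<^sup>+x. ennreal (exp (a * (X x)\<^sup>2 / 2)) \<partial>M) \<le> ennreal (1 / sqrt (1 - a * v))"
proof -
  let ?G = std_normal_distribution
  interpret G: prob_space ?G
    by (rule prob_space_normal_density) simp
  interpret M: sigma_finite_measure M by fact
  interpret P: pair_sigma_finite M ?G ..
  have "(\<integral>\<^sup>+x. ennreal (exp (a * (X x)\<^sup>2 / 2)) \<partial>M)
      = (\<integral>\<^sup>+x. \<integral>\<^sup>+z. ennreal (exp (sqrt a * X x * z)) \<partial>?G \<partial>M)"
    using a(1) by (simp add: std_normal_exp_linear power_mult_distrib)
  also have "\<dots> = (\<integral>\<^sup>+z. \<integral>\<^sup>+x. ennreal (exp (sqrt a * X x * z)) \<partial>M \<partial>?G)"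
    by (rule P.Fubini'[symmetric]) measurable
  also have "\<dots> \<le> (\<integral>\<^sup>+z. ennreal (exp (a * v * z\<^sup>2 / 2)) \<partial>?G)"
  proof (intro nn_integral_mono)
    fix z
    show "(\<integral>\<^sup>+x. ennreal (exp (sqrt a * X x * z)) \<partial>M) \<le> ennreal (exp (a * v * z\<^sup>2 / 2))"
      using mgf[of "sqrt a * z"] a(1) by (simp add: power_mult_distrib mult_ac)
  qed
  also have "\<dots> = ennreal (1 / sqrt (1 - a * v))"
    using a(2) by (rule std_normal_exp_square)
  finally show ?thesis .
qed

lemma subgaussian_exp_square_sum:
  fixes w X :: "'a \<Rightarrow> real"
  assumes A: "finite A" and w: "\<And>x. x \<in> A \<Longrightarrow> 0 \<le> w x"
    and mgf: "\<And>s. (\<Sum>x\<in>A. w x * exp (s * X x)) \<le> exp (v * s\<^sup>2 / 2)"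
    and a: "0 \<le> a" "a * v < 1"
  shows "(\<Sum>x\<in>A. w x * exp (a * (X x)\<^sup>2 / 2)) \<le> 1 / sqrt (1 - a * v)"
proof -
  have eq: "(\<integral>\<^sup>+x. ennreal (f x) \<partial>point_measure A (\<lambda>x. ennreal (w x)))
      = ennreal (\<Sum>x\<in>A. w x * f x)" if "\<And>x. 0 \<le> f x" for f
    using A w that
    by (simp add: nn_integral_point_measure_finite ennreal_mult sum_nonneg flip: sum_ennreal)
  have "finite_measure (point_measure A (\<lambda>x. ennreal (w x)))"
    by (rule finite_measureI) (use A in \<open>simp add: space_point_measure emeasure_point_measure_finite\<close>)
  then have "sigma_finite_measure (point_measure A (\<lambda>x. ennreal (w x)))"
    by (simp add: finite_measure_def)
  from subgaussian_exp_square[OF this, of X v a] mgf a show ?thesis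
    by (simp add: eq)
qed

text \<open>
  Hoeffding's lemma for a spin with mean \<open>p\<close>.
\<close>
lemma two_point_mgf:
  fixes p s :: real
  assumes "\<bar>p\<bar> \<le> 1"
  shows "(1 + p) / 2 * exp (s * (1 - p)) + (1 - p) / 2 * exp (s * (- 1 - p)) \<le> exp (s\<^sup>2 / 2)"
proof -
  have *: "(1 + p) / 2 * exp (s * (1 - p)) + (1 - p) / 2 * exp (s * (- 1 - p)) \<le> exp (s\<^sup>2 / 2)"
    if p: "\<bar>p\<bar> \<le> 1" and s: "0 \<le> s" for p s :: real
  proof -
    \<comment> \<open>With \<open>r\<close> the probability of \<open>+1\<close>, this is the Bernoulli case of Hoeffding's lemma at \<open>2 * s\<close>.\<close>
    define r where "r = (1 + p) / 2"
    have r: "0 \<le> r" "r \<le> 1" using p by (auto simp: r_def)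
    have "0 \<le> r * (exp (2 * s) - 1)" using r s by simp
    then have pos: "0 < 1 + r * (exp (2 * s) - 1)" by linarith
    have "(1 + p) / 2 * exp (s * (1 - p)) + (1 - p) / 2 * exp (s * (- 1 - p))
        = exp (- (2 * s) * r) * (1 + r * (exp (2 * s) - 1))"
    proof -
      have "s * (1 - p) = - (2 * s) * r + 2 * s" "s * (- 1 - p) = - (2 * s) * r"
        by (simp_all add: r_def field_simps)
      then have "exp (s * (1 - p)) = exp (- (2 * s) * r) * exp (2 * s)"
        "exp (s * (- 1 - p)) = exp (- (2 * s) * r)"
        by (simp_all only: exp_add)
      moreover have "(1 - p) / 2 = 1 - r"
        by (simp add: r_def field_simps)
      ultimately show ?thesis
        by (simp only: r_def[symmetric]) (simp add: algebra_simps)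
    qed
    also have "\<dots> = exp (- (2 * s) * r + ln (1 + r * (exp (2 * s) - 1)))"
      using pos by (simp only: exp_add exp_ln)
    also have "\<dots> \<le> exp (s\<^sup>2 / 2)"
      using Hoeffdings_lemma_aux[of "2 * s" r] r s by (simp add: power_mult_distrib)
    finally show ?thesis .
  qed
  show ?thesis
  proof (cases "0 \<le> s")
    case False
    with *[of "- p" "- s"] assms show ?thesis
      by (simp add: algebra_simps)
  qed (use * assms in auto)
qed

text \<open>
  Hoeffding's lemma; the case of negative \<open>s\<close> is that of \<open>- s\<close> and \<open>- f\<close>.
\<close>
lemma bounded_centered_mgf:
  fixes f :: "'a \<Rightarrow> real"
  assumes "prob_space M" and f [measurable]: "f \<in> borel_measurable M"
    and bd: "\<And>x. \<bar>f x\<bar> \<le> 1"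
  shows "(\<integral>\<^sup>+x. ennreal (exp (s * (f x - integral\<^sup>L M f))) \<partial>M) \<le> ennreal (exp (s\<^sup>2 / 2))"
proof -
  interpret prob_space M by fact
  have *: "(\<integral>\<^sup>+x. ennreal (exp (s * (f x - integral\<^sup>L M f))) \<partial>M) \<le> ennreal (exp (s\<^sup>2 / 2))"
    if f [measurable]: "f \<in> borel_measurable M" and bd: "\<And>x. \<bar>f x\<bar> \<le> 1" and s: "0 < s"
    for f and s :: real
  proof -
    interpret interval_bounded_random_variable M f "- 1" 1
      by unfold_locales (use bd in \<open>auto simp: abs_le_iff minus_le_iff\<close>)
    show ?thesis
      using Hoeffdings_lemma_nn_integral[OF s] by simp
  qed
  consider "s > 0" | "s = 0" | "s < 0" by linarith
  then show ?thesis
  proof cases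
    case 1 then show ?thesis using *[of f s] bd by simp
  next
    case 2 then show ?thesis by (simp add: emeasure_space_1)
  next
    case 3 then show ?thesis using *[of "\<lambda>x. - f x" "- s"] bd by (simp add: algebra_simps)
  qed
qed

lemma iid_mean_exp_square:
  fixes f :: "'a \<Rightarrow> real"
  assumes M: "prob_space M" and f [measurable]: "f \<in> borel_measurable M"
    and bd: "\<And>x. \<bar>f x\<bar> \<le> 1" and n: "0 < n" and a: "0 \<le> a" "a < 1"
  shows "(\<integral>\<^sup>+h. ennreal (exp (a * real n * ((\<Sum>i=1..n. f (h i)) / real n - integral\<^sup>L M f)\<^sup>2 / 2))
      \<partial>Pi\<^sub>M {1..n} (\<lambda>_. M)) \<le> ennreal (1 / sqrt (1 - a))"
proof -
  let ?P = "Pi\<^sub>M {1..n} (\<lambda>_. M)" and ?X = "\<lambda>h. \<Sum>i=1..n. f (h i) - integral\<^sup>L M f"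
  interpret M: prob_space M by fact
  interpret product_sigma_finite "\<lambda>_::nat. M" ..
  have P: "prob_space ?P"
    by (intro prob_space_PiM M)
  have mgf: "(\<integral>\<^sup>+h. ennreal (exp (s * ?X h)) \<partial>?P) \<le> ennreal (exp (real n * s\<^sup>2 / 2))" for s
  proof -
    have "(\<integral>\<^sup>+h. ennreal (exp (s * ?X h)) \<partial>?P)
        = (\<integral>\<^sup>+h. (\<Prod>i\<in>{1..n}. ennreal (exp (s * (f (h i) - integral\<^sup>L M f)))) \<partial>?P)"
      by (simp add: sum_distrib_left exp_sum prod_ennreal)
    also have "\<dots> = (\<Prod>i\<in>{1..n}. \<integral>\<^sup>+x. ennreal (exp (s * (f x - integral\<^sup>L M f))) \<partial>M)"
      by (rule product_nn_integral_prod) auto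
    also have "\<dots> \<le> (\<Prod>i\<in>{1..n}. ennreal (exp (s\<^sup>2 / 2)))"
      by (intro prod_mono_ennreal bounded_centered_mgf M f bd)
    also have "\<dots> = ennreal (exp (real n * s\<^sup>2 / 2))"
      by (simp add: ennreal_power exp_of_nat_mult[symmetric])
    finally show ?thesis .
  qed
  have "(\<integral>\<^sup>+h. ennreal (exp (a / real n * (?X h)\<^sup>2 / 2)) \<partial>?P)
      \<le> ennreal (1 / sqrt (1 - a / real n * real n))"
    by (rule subgaussian_exp_square[OF _ _ mgf])
       (use a n P in \<open>auto simp: prob_space_imp_sigma_finite\<close>)
  moreover have "a / real n * (?X h)\<^sup>2 / 2
      = a * real n * ((\<Sum>i=1..n. f (h i)) / real n - integral\<^sup>L M f)\<^sup>2 / 2" for h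
  proof -
    have "?X h = real n * ((\<Sum>i=1..n. f (h i)) / real n - integral\<^sup>L M f)"
      using n by (simp add: sum_subtractf field_simps)
    then show ?thesis
      using n by (simp add: power_mult_distrib power2_eq_square)
  qed
  ultimately show ?thesis
    using n by (simp only:) simp
qed

section \<open>Independent spins\<close>

text \<open>
  The law of independent spins with means \<open>p i\<close>.
\<close>
definition spin_law :: "nat \<Rightarrow> (nat \<Rightarrow> real) \<Rightarrow> (nat \<Rightarrow> real) \<Rightarrow> real" where
  "spin_law n p \<sigma> = (\<Prod>i=1..n. (1 + p i * \<sigma> i) / 2)"

lemma finite_spins [simp]: "finite (spins n)"
  by (auto simp: spins_def intro: finite_PiE)

lemma spins_cases: "\<sigma> \<in> spins n \<Longrightarrow> i \<in> {1..n} \<Longrightarrow> \<sigma> i = -1 \<or> \<sigma> i = 1"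
  by (auto simp: spins_def PiE_iff)

lemma spin_law_nonneg:
  assumes "\<And>i. \<bar>p i\<bar> \<le> 1" "\<sigma> \<in> spins n"
  shows "0 \<le> spin_law n p \<sigma>"
  unfolding spin_law_def
proof (intro prod_nonneg)
  fix i assume "i \<in> {1..n}"
  with spins_cases[OF assms(2) this] assms(1)[of i] show "0 \<le> (1 + p i * \<sigma> i) / 2"
    by (auto simp: abs_le_iff)
qed

text \<open>
  Every use of the independence of the spins goes through this factorization, an instance of the
  distributive law over all configurations.
\<close>
lemma sum_spin_law_prod:
  "(\<Sum>\<sigma>\<in>spins n. spin_law n p \<sigma> * (\<Prod>i=1..n. f i (\<sigma> i)))
    = (\<Prod>i=1..n. (1 + p i) / 2 * f i 1 + (1 - p i) / 2 * f i (- 1))"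
proof -
  have "(\<Prod>i=1..n. (1 + p i) / 2 * f i 1 + (1 - p i) / 2 * f i (- 1))
      = (\<Prod>i=1..n. \<Sum>y\<in>{- 1, 1}. (1 + p i * y) / 2 * f i y)"
    by (intro prod.cong refl) simp
  also have "\<dots> = (\<Sum>\<sigma>\<in>spins n. \<Prod>i=1..n. (1 + p i * \<sigma> i) / 2 * f i (\<sigma> i))"
    unfolding spins_def by (rule prod_sum_PiE) auto
  finally show ?thesis
    by (simp only: spin_law_def prod.distrib)
qed

lemma sum_spin_law: "(\<Sum>\<sigma>\<in>spins n. spin_law n p \<sigma>) = 1"
proof -
  have "(1 + p i) / 2 * 1 + (1 - p i) / 2 * 1 = 1" for i
    by (simp add: field_simps)
  then show ?thesis
    using sum_spin_law_prod[of n p "\<lambda>_ _. 1"] by (simp only:) simp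
qed

lemma spin_law_mgf:
  assumes p: "\<And>i. \<bar>p i\<bar> \<le> 1" and c: "\<And>i. i \<in> {1..n} \<Longrightarrow> \<bar>c i\<bar> \<le> 1"
  shows "(\<Sum>\<sigma>\<in>spins n. spin_law n p \<sigma> * exp (s * (\<Sum>i=1..n. c i * (\<sigma> i - p i))))
    \<le> exp (real n * s\<^sup>2 / 2)"
proof -
  have "(\<Sum>\<sigma>\<in>spins n. spin_law n p \<sigma> * exp (s * (\<Sum>i=1..n. c i * (\<sigma> i - p i))))
      = (\<Sum>\<sigma>\<in>spins n. spin_law n p \<sigma> * (\<Prod>i=1..n. exp (s * c i * (\<sigma> i - p i))))"
    by (simp add: sum_distrib_left exp_sum mult.assoc)
  also have "\<dots> = (\<Prod>i=1..n. (1 + p i) / 2 * exp (s * c i * (1 - p i))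
                         + (1 - p i) / 2 * exp (s * c i * (- 1 - p i)))"
    by (rule sum_spin_law_prod)
  also have "\<dots> \<le> (\<Prod>i=1..n. exp (s\<^sup>2 / 2))"
  proof (intro prod_mono conjI)
    fix i assume i: "i \<in> {1..n}"
    show "0 \<le> (1 + p i) / 2 * exp (s * c i * (1 - p i)) + (1 - p i) / 2 * exp (s * c i * (- 1 - p i))"
      using p[of i] by (intro add_nonneg_nonneg mult_nonneg_nonneg) (auto simp: abs_le_iff)
    have "(s * c i)\<^sup>2 \<le> s\<^sup>2"
      using c[OF i] by (simp add: power_mult_distrib mult_left_le abs_square_le_1)
    then have "exp ((s * c i)\<^sup>2 / 2) \<le> exp (s\<^sup>2 / 2)"
      by simp
    with two_point_mgf[OF p, of i "s * c i"]
    show "(1 + p i) / 2 * exp (s * c i * (1 - p i)) + (1 - p i) / 2 * exp (s * c i * (- 1 - p i))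
        \<le> exp (s\<^sup>2 / 2)"
      by linarith
  qed
  also have "\<dots> = exp (real n * s\<^sup>2 / 2)"
    by (simp add: exp_of_nat_mult[symmetric])
  finally show ?thesis .
qed

text \<open>
  The coefficients \<open>c\<close> allow three uses: \<open>1\<close> for the magnetization, and \<open>\<tau>\<close> or \<open>p\<close> for the two parts of the
  overlap.
\<close>
lemma spin_law_exp_square:
  assumes p: "\<And>i. \<bar>p i\<bar> \<le> 1" and c: "\<And>i. i \<in> {1..n} \<Longrightarrow> \<bar>c i\<bar> \<le> 1"
    and n: "0 < n" and a: "0 \<le> a" "a < 1"
  shows "(\<Sum>\<sigma>\<in>spins n. spin_law n p \<sigma> * exp (a * ((\<Sum>i=1..n. c i * (\<sigma> i - p i))\<^sup>2 / (2 * real n))))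
    \<le> 1 / sqrt (1 - a)"
proof -
  have "(\<Sum>\<sigma>\<in>spins n. spin_law n p \<sigma> * exp (a / real n * (\<Sum>i=1..n. c i * (\<sigma> i - p i))\<^sup>2 / 2))
      \<le> 1 / sqrt (1 - a / real n * real n)"
    by (rule subgaussian_exp_square_sum[OF _ _ spin_law_mgf])
       (use p c n a in \<open>auto intro!: spin_law_nonneg\<close>)
  moreover have "a / real n * y / 2 = a * (y / (2 * real n))" for y
    by simp
  ultimately show ?thesis
    using n by (simp only:) simp
qed

text \<open>
  The exponent puts weight \<open>b\<close> on the two magnetization squares together and \<open>(1 - b) / 4\<close> on each of the
  two overlap squares. The total weight \<open>b + (1 - b) / 2 = a\<close> is below \<open>1\<close>, so the exponential is at
  most the sum of three exponentials, each with coefficient \<open>a\<close> on one kind of square. These can be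
  averaged separately: the two magnetizations are independent, \<open>\<Sum> \<tau>\<^sub>i (\<sigma>\<^sub>i - p\<^sub>i)\<close> is handled with \<open>\<tau>\<close>
  frozen, and \<open>\<Sum> p\<^sub>i (\<tau>\<^sub>i - p\<^sub>i)\<close> involves \<open>\<tau>\<close> alone.
\<close>
lemma two_replica_bound:
  assumes p: "\<And>i. \<bar>p i\<bar> \<le> 1" and n: "0 < n" and b: "0 \<le> b" "b < 1"
  defines "a \<equiv> (1 + b) / 2"
  shows "(\<Sum>\<sigma>\<in>spins n. \<Sum>\<tau>\<in>spins n. spin_law n p \<sigma> * spin_law n p \<tau> *
      exp (b * (((\<Sum>i=1..n. \<sigma> i - p i)\<^sup>2 + (\<Sum>i=1..n. \<tau> i - p i)\<^sup>2) / (2 * real n))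
         + (1 - b) / 4 * (((\<Sum>i=1..n. \<tau> i * (\<sigma> i - p i))\<^sup>2 + (\<Sum>i=1..n. p i * (\<tau> i - p i))\<^sup>2) / (2 * real n))))
    \<le> 1 / (1 - a) + 2 / sqrt (1 - a)"
proof -
  have a: "0 \<le> a" "a < 1" using b by (auto simp: a_def)
  let ?P = "spin_law n p"
  define sq where "sq c \<sigma> = (\<Sum>i=1..n. c i * (\<sigma> i - p i))\<^sup>2 / (2 * real n)" for c \<sigma> :: "nat \<Rightarrow> real"
  let ?e = "\<lambda>c \<sigma>. exp (a * sq c \<sigma>)"
  have P0: "0 \<le> ?P \<sigma>" if "\<sigma> \<in> spins n" for \<sigma>
    using p that by (rule spin_law_nonneg)
  have sq_le: "(\<Sum>\<sigma>\<in>spins n. ?P \<sigma> * ?e c \<sigma>) \<le> 1 / sqrt (1 - a)"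
    if "\<And>i. i \<in> {1..n} \<Longrightarrow> \<bar>c i\<bar> \<le> 1" for c
    unfolding sq_def using p that n a by (rule spin_law_exp_square)
  have "(\<Sum>\<sigma>\<in>spins n. \<Sum>\<tau>\<in>spins n. ?P \<sigma> * ?P \<tau> *
        exp (b * (sq (\<lambda>_. 1) \<sigma> + sq (\<lambda>_. 1) \<tau>) + (1 - b) / 4 * (sq \<tau> \<sigma> + sq p \<tau>)))
      \<le> (\<Sum>\<sigma>\<in>spins n. \<Sum>\<tau>\<in>spins n. ?P \<sigma> * ?P \<tau> *
          (?e (\<lambda>_. 1) \<sigma> * ?e (\<lambda>_. 1) \<tau> + ?e \<tau> \<sigma> + ?e p \<tau>))"
  proof (intro sum_mono mult_left_mono)
    fix \<sigma> \<tau> assume "\<sigma> \<in> spins n" "\<tau> \<in> spins n"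
    define U V W where "U = sq (\<lambda>_. 1) \<sigma> + sq (\<lambda>_. 1) \<tau>" and "V = sq \<tau> \<sigma>" and "W = sq p \<tau>"
    define M where "M = max U (max V W)"
    have "b * U \<le> b * M" "(1 - b) / 4 * V \<le> (1 - b) / 4 * M" "(1 - b) / 4 * W \<le> (1 - b) / 4 * M"
      using b by (auto simp: M_def intro!: mult_left_mono)
    then have "b * U + (1 - b) / 4 * (V + W) \<le> b * M + (1 - b) / 4 * M + (1 - b) / 4 * M"
      unfolding distrib_left by linarith
    also have "\<dots> = a * M"
      by (simp add: a_def field_simps)
    finally have "exp (b * U + (1 - b) / 4 * (V + W)) \<le> exp (a * M)"
      by simp
    also have "\<dots> \<le> exp (a * U) + exp (a * V) + exp (a * W)"
      by (auto simp: M_def max_def add_nonneg_nonneg)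
    finally show "exp (b * (sq (\<lambda>_. 1) \<sigma> + sq (\<lambda>_. 1) \<tau>) + (1 - b) / 4 * (sq \<tau> \<sigma> + sq p \<tau>))
        \<le> ?e (\<lambda>_. 1) \<sigma> * ?e (\<lambda>_. 1) \<tau> + ?e \<tau> \<sigma> + ?e p \<tau>"
      by (simp add: U_def V_def W_def distrib_left exp_add)
  qed (simp add: P0)
  also have "\<dots> = (\<Sum>\<sigma>\<in>spins n. ?P \<sigma> * ?e (\<lambda>_. 1) \<sigma>) * (\<Sum>\<tau>\<in>spins n. ?P \<tau> * ?e (\<lambda>_. 1) \<tau>)
      + (\<Sum>\<tau>\<in>spins n. ?P \<tau> * (\<Sum>\<sigma>\<in>spins n. ?P \<sigma> * ?e \<tau> \<sigma>))
      + (\<Sum>\<sigma>\<in>spins n. ?P \<sigma>) * (\<Sum>\<tau>\<in>spins n. ?P \<tau> * ?e p \<tau>)"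
  proof -
    have "(\<Sum>\<sigma>\<in>spins n. \<Sum>\<tau>\<in>spins n. ?P \<sigma> * ?P \<tau> * ?e \<tau> \<sigma>)
        = (\<Sum>\<tau>\<in>spins n. ?P \<tau> * (\<Sum>\<sigma>\<in>spins n. ?P \<sigma> * ?e \<tau> \<sigma>))"
      by (subst sum.swap) (simp add: sum_distrib_left mult_ac)
    then show ?thesis
      by (simp add: sum_product distrib_left sum.distrib mult_ac)
  qed
  also have "\<dots> \<le> 1 / sqrt (1 - a) * (1 / sqrt (1 - a))
      + (\<Sum>\<tau>\<in>spins n. ?P \<tau> * (1 / sqrt (1 - a))) + 1 * (1 / sqrt (1 - a))"
    unfolding sum_spin_law
  proof (intro add_mono mult_mono sum_mono mult_left_mono sq_le)
    fix \<tau> i assume "\<tau> \<in> spins n" "i \<in> {1..n}"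
    then show "\<bar>\<tau> i\<bar> \<le> 1" using spins_cases by fastforce
  qed (use a p in \<open>auto intro!: sum_nonneg mult_nonneg_nonneg P0\<close>)
  also have "\<dots> = 1 / (1 - a) + 2 / sqrt (1 - a)"
    using a by (simp add: sum_distrib_right[symmetric] sum_spin_law sum_divide_distrib[symmetric])
  finally show ?thesis
    by (simp add: sq_def add_divide_distrib)
qed

section \<open>Comparison of the Gibbs measure with a product measure\<close>

lemma abs_tanh_le_one: "\<bar>tanh x\<bar> \<le> 1" for x :: real
  using tanh_real_bounds[of x] by (auto simp: abs_le_iff)

lemma tanh_lipschitz: "\<bar>tanh x - tanh y\<bar> \<le> \<bar>x - y\<bar>" for x y :: real
proof -
  have deriv: "(tanh has_real_derivative 1 - (tanh z)\<^sup>2) (at z)" for z :: real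
    by (auto intro!: derivative_eq_intros)
  have *: "\<bar>tanh x - tanh y\<bar> \<le> \<bar>x - y\<bar>" if xy: "x < y" for x y :: real
  proof -
    obtain z where z: "tanh y - tanh x = (y - x) * (1 - (tanh z)\<^sup>2)"
      using MVT2[OF xy, of tanh "\<lambda>z. 1 - (tanh z)\<^sup>2"] deriv by blast
    have "(tanh z)\<^sup>2 \<le> 1"
      using abs_tanh_le_one[of z] by (simp add: abs_square_le_1)
    then have "\<bar>1 - (tanh z)\<^sup>2\<bar> \<le> 1" by simp
    then have "\<bar>tanh y - tanh x\<bar> \<le> \<bar>y - x\<bar>"
      by (simp add: z abs_mult mult_left_le)
    then show ?thesis by linarith
  qed
  show ?thesis
    using *[of x y] *[of y x] by (cases x y rule: linorder_cases) auto
qed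

text \<open>
  The average lies in \<open>[-1, 1]\<close>, so \<open>x\<close> minus the average changes sign on that interval.
\<close>
lemma ex_mean_field_solution:
  fixes b :: real
  assumes n: "0 < n"
  obtains x where "x = (\<Sum>i=1..n. tanh (b * x + h i)) / real n"
proof -
  let ?f = "\<lambda>x. (\<Sum>i=1..n. tanh (b * x + h i)) / real n"
  have bound: "\<bar>?f x\<bar> \<le> 1" for x
  proof -
    have "\<bar>\<Sum>i=1..n. tanh (b * x + h i)\<bar> \<le> (\<Sum>i=1..n. 1)"
      by (intro order.trans[OF sum_abs] sum_mono abs_tanh_le_one)
    then show ?thesis using n by (simp add: divide_le_eq)
  qed
  have "\<exists>x\<ge>-1. x \<le> 1 \<and> x - ?f x = 0"
  proof (rule IVT')
    show "- 1 - ?f (- 1) \<le> 0" "0 \<le> 1 - ?f 1"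
      using bound[of "- 1"] bound[of 1] unfolding abs_le_iff by linarith+
    show "continuous_on {- 1..1} (\<lambda>x. x - ?f x)"
      using n by (intro continuous_intros) auto
  qed simp
  then show thesis using that by auto
qed

text \<open>
  Without interaction the Gibbs measure of a field \<open>y\<close> is the product measure with means \<open>tanh (y i)\<close>.
\<close>
lemma exp_field_eq_spin_law:
  assumes "\<sigma> \<in> spins n"
  shows "exp (\<Sum>i=1..n. y i * \<sigma> i) = (\<Prod>i=1..n. 2 * cosh (y i)) * spin_law n (\<lambda>i. tanh (y i)) \<sigma>"
proof -
  have "exp (\<Sum>i=1..n. y i * \<sigma> i) = (\<Prod>i=1..n. exp (y i * \<sigma> i))"
    by (simp add: exp_sum)
  also have "\<dots> = (\<Prod>i=1..n. 2 * cosh (y i) * ((1 + tanh (y i) * \<sigma> i) / 2))"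
  proof (intro prod.cong refl)
    fix i assume "i \<in> {1..n}"
    moreover have "exp (y i) = cosh (y i) + sinh (y i)" "exp (- y i) = cosh (y i) - sinh (y i)"
      by (simp_all add: cosh_plus_sinh cosh_minus_sinh)
    ultimately show "exp (y i * \<sigma> i) = 2 * cosh (y i) * ((1 + tanh (y i) * \<sigma> i) / 2)"
      using spins_cases[OF assms, of i] by (auto simp: tanh_def distrib_left right_diff_distrib)
  qed
  finally show ?thesis
    by (simp only: spin_law_def prod.distrib)
qed

lemma gibbs_nonneg: "0 \<le> gibbs n \<beta> h \<sigma>"
  by (auto simp: gibbs_def partition_fun_def gibbs_weight_def intro!: divide_nonneg_nonneg sum_nonneg)

text \<open>
  Expanding \<open>(\<Sum>\<sigma>\<^sub>i)\<^sup>2\<close> around \<open>n * x\<close> turns the interaction into the extra field \<open>\<beta>\<^sup>2 * x\<close>, a constant, and a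
  square that is centred under the product measure because \<open>x\<close> is the average of the \<open>p i\<close>. The
  exponential of that square is at least \<open>1\<close>, which bounds the partition function from below.
\<close>
lemma gibbs_le_spin_law:
  assumes n: "0 < n" and x: "x = (\<Sum>i=1..n. tanh (\<beta>\<^sup>2 * x + h i)) / real n"
    and p: "\<And>i. p i = tanh (\<beta>\<^sup>2 * x + h i)" and \<sigma>: "\<sigma> \<in> spins n"
  shows "gibbs n \<beta> h \<sigma>
    \<le> spin_law n p \<sigma> * exp (\<beta>\<^sup>2 * ((\<Sum>i=1..n. \<sigma> i - p i)\<^sup>2 / (2 * real n)))"
proof -
  let ?W = "\<lambda>\<sigma>. exp (\<beta>\<^sup>2 * ((\<Sum>i=1..n. \<sigma> i - p i)\<^sup>2 / (2 * real n)))"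
  \<comment> \<open>\<open>K\<close> collects the factors of the weight that do not depend on the configuration.\<close>
  define K where "K = exp (- \<beta>\<^sup>2 * real n * x\<^sup>2 / 2) * (\<Prod>i=1..n. 2 * cosh (\<beta>\<^sup>2 * x + h i))"
  have K: "K > 0"
    by (auto simp: K_def intro!: mult_pos_pos prod_pos)
  have "(\<Sum>i=1..n. p i) = (\<Sum>i=1..n. tanh (\<beta>\<^sup>2 * x + h i))"
    by (intro sum.cong refl p)
  also have "\<dots> = real n * ((\<Sum>i=1..n. tanh (\<beta>\<^sup>2 * x + h i)) / real n)"
    using n by simp
  finally have px: "(\<Sum>i=1..n. p i) = real n * x"
    by (simp only: x[symmetric])
  have weight: "gibbs_weight n \<beta> h \<sigma> = K * (spin_law n p \<sigma> * ?W \<sigma>)" if "\<sigma> \<in> spins n" for \<sigma>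
  proof -
    let ?S = "\<Sum>i=1..n. \<sigma> i"
    have "(\<Sum>i=1..n. \<sigma> i - p i) = ?S - real n * x"
      by (simp only: sum_subtractf px)
    moreover have "(\<Sum>i=1..n. (\<beta>\<^sup>2 * x + h i) * \<sigma> i) = \<beta>\<^sup>2 * x * ?S + (\<Sum>i=1..n. h i * \<sigma> i)"
      by (simp add: algebra_simps sum.distrib sum_distrib_left)
    moreover have "\<beta>\<^sup>2 / (2 * real n) * ?S\<^sup>2
        = - \<beta>\<^sup>2 * real n * x\<^sup>2 / 2 + \<beta>\<^sup>2 * x * ?S + \<beta>\<^sup>2 * ((?S - real n * x)\<^sup>2 / (2 * real n))"
      using n by (simp add: field_simps power2_eq_square)
    ultimately have "gibbs_weight n \<beta> h \<sigma>
        = exp (- \<beta>\<^sup>2 * real n * x\<^sup>2 / 2) * exp (\<Sum>i=1..n. (\<beta>\<^sup>2 * x + h i) * \<sigma> i) * ?W \<sigma>"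
      by (simp add: gibbs_weight_def mult_exp_exp)
    then show ?thesis
      using exp_field_eq_spin_law[OF that, of "\<lambda>i. \<beta>\<^sup>2 * x + h i"] by (simp add: K_def p[abs_def])
  qed
  have "K * 1 \<le> K * (\<Sum>\<sigma>\<in>spins n. spin_law n p \<sigma> * ?W \<sigma>)"
  proof (intro mult_left_mono)
    have "(\<Sum>\<sigma>\<in>spins n. spin_law n p \<sigma>) \<le> (\<Sum>\<sigma>\<in>spins n. spin_law n p \<sigma> * ?W \<sigma>)"
    proof (intro sum_mono)
      fix \<sigma> assume "\<sigma> \<in> spins n"
      then have "0 \<le> spin_law n p \<sigma>"
        by (intro spin_law_nonneg) (auto simp: p intro: abs_tanh_le_one)
      then show "spin_law n p \<sigma> \<le> spin_law n p \<sigma> * ?W \<sigma>"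
        by (simp add: mult_le_cancel_left1)
    qed
    then show "1 \<le> (\<Sum>\<sigma>\<in>spins n. spin_law n p \<sigma> * ?W \<sigma>)"
      by (simp add: sum_spin_law)
  qed (use K in simp)
  then have Z: "K \<le> partition_fun n \<beta> h"
    by (simp add: partition_fun_def weight sum_distrib_left)
  have "gibbs n \<beta> h \<sigma> \<le> gibbs_weight n \<beta> h \<sigma> / K"
    unfolding gibbs_def using Z K by (intro divide_left_mono) (auto simp: gibbs_weight_def)
  also have "\<dots> = spin_law n p \<sigma> * ?W \<sigma>"
    using K by (simp add: weight[OF \<sigma>])
  finally show ?thesis .
qed

section \<open>Concentration of the overlap\<close>

lemma square_sum4_le: "(u + v + w + z)\<^sup>2 \<le> 4 * (u\<^sup>2 + v\<^sup>2 + w\<^sup>2 + z\<^sup>2)" for u v w z :: real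
proof -
  have "0 \<le> (u - v)\<^sup>2 + (u - w)\<^sup>2 + (u - z)\<^sup>2 + (v - w)\<^sup>2 + (v - z)\<^sup>2 + (w - z)\<^sup>2"
    by simp
  then show ?thesis by (simp add: power2_eq_square algebra_simps)
qed

text \<open>
  The fluctuations \<open>F\<close> and \<open>E\<close> are taken at the deterministic \<open>m\<close>, so that the right-hand side is an
  explicit function of the field and the auxiliary solution \<open>x\<close> is gone. The restriction on \<open>l\<close> makes
  the overlap squares, after the factor \<open>4\<close> from \<open>square_sum4_le\<close>, fit the weight \<open>(1 - \<beta>\<^sup>2) / 4\<close> of
  \<open>two_replica_bound\<close>.
\<close>
lemma overlap_bound_given_field:
  fixes \<beta> m q :: real and h :: "nat \<Rightarrow> real"
  assumes n: "0 < n" and b: "\<beta>\<^sup>2 < 1" and l: "0 \<le> l" "l \<le> (1 - \<beta>\<^sup>2) / 32"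
  defines "a \<equiv> (1 + \<beta>\<^sup>2) / 2"
    and "F \<equiv> (\<Sum>i=1..n. tanh (\<beta>\<^sup>2 * m + h i)) / real n - m"
    and "E \<equiv> (\<Sum>i=1..n. (tanh (\<beta>\<^sup>2 * m + h i))\<^sup>2) / real n - q"
  shows "gibbs_avg n \<beta> h (\<lambda>\<sigma> \<tau>. exp (l * real n * (overlap n \<sigma> \<tau> - q)\<^sup>2))
    \<le> (1 / (1 - a) + 2 / sqrt (1 - a)) * exp (4 * l * real n * (4 * F\<^sup>2 / (1 - \<beta>\<^sup>2)\<^sup>2 + E\<^sup>2))"
proof -
  obtain x where x: "x = (\<Sum>i=1..n. tanh (\<beta>\<^sup>2 * x + h i)) / real n"
    using ex_mean_field_solution[OF n] by blast
  define p where "p i = tanh (\<beta>\<^sup>2 * x + h i)" for i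
  define r where "r i = tanh (\<beta>\<^sup>2 * m + h i)" for i
  have p1: "\<bar>p i\<bar> \<le> 1" and r1: "\<bar>r i\<bar> \<le> 1" for i
    by (simp_all add: p_def r_def abs_tanh_le_one)
  have pr: "\<bar>p i - r i\<bar> \<le> \<beta>\<^sup>2 * \<bar>x - m\<bar>" for i
    using tanh_lipschitz[of "\<beta>\<^sup>2 * x + h i" "\<beta>\<^sup>2 * m + h i"]
    by (simp add: p_def r_def abs_mult flip: right_diff_distrib)
  have mean_le: "\<bar>(\<Sum>i=1..n. f i) / real n\<bar> \<le> c" if "\<And>i. \<bar>f i\<bar> \<le> c" for f :: "nat \<Rightarrow> real" and c
  proof -
    have "\<bar>\<Sum>i=1..n. f i\<bar> \<le> (\<Sum>i=1..n. c)"
      by (intro order.trans[OF sum_abs] sum_mono that)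
    then show ?thesis using n by (simp add: divide_le_eq mult.commute)
  qed
  \<comment> \<open>The empirical map is a contraction with constant \<open>\<beta>\<^sup>2\<close> whose fixed point is \<open>x\<close>; it moves \<open>m\<close> by \<open>F\<close>.\<close>
  have xm: "(1 - \<beta>\<^sup>2) * \<bar>x - m\<bar> \<le> \<bar>F\<bar>"
  proof -
    have "x - m = (\<Sum>i=1..n. p i - r i) / real n + F"
      using x by (simp add: F_def p_def r_def sum_subtractf diff_divide_distrib)
    then have "\<bar>x - m\<bar> \<le> \<beta>\<^sup>2 * \<bar>x - m\<bar> + \<bar>F\<bar>"
      using mean_le[of "\<lambda>i. p i - r i", OF pr] by linarith
    then show ?thesis by (simp add: algebra_simps)
  qed
  define E1 where "E1 = (\<Sum>i=1..n. (p i)\<^sup>2 - (r i)\<^sup>2) / real n"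
  have "\<bar>E1\<bar> \<le> 2 * \<bar>x - m\<bar>"
    unfolding E1_def
  proof (rule mean_le)
    fix i
    have "\<bar>(p i)\<^sup>2 - (r i)\<^sup>2\<bar> = \<bar>p i - r i\<bar> * \<bar>p i + r i\<bar>"
      by (simp add: power2_eq_square algebra_simps flip: abs_mult)
    also have "\<dots> \<le> \<bar>x - m\<bar> * 2"
    proof (intro mult_mono)
      show "\<bar>p i - r i\<bar> \<le> \<bar>x - m\<bar>"
        using pr[of i] mult_right_mono[OF less_imp_le[OF b], of "\<bar>x - m\<bar>"] by simp
      show "\<bar>p i + r i\<bar> \<le> 2"
        using p1[of i] r1[of i] by linarith
    qed auto
    finally show "\<bar>(p i)\<^sup>2 - (r i)\<^sup>2\<bar> \<le> 2 * \<bar>x - m\<bar>" by simp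
  qed
  also have "\<dots> \<le> 2 * (\<bar>F\<bar> / (1 - \<beta>\<^sup>2))"
    using xm b by (simp add: pos_le_divide_eq mult.commute)
  finally have E1: "E1\<^sup>2 \<le> 4 * F\<^sup>2 / (1 - \<beta>\<^sup>2)\<^sup>2"
    using power_mono[of "\<bar>E1\<bar>" "2 * (\<bar>F\<bar> / (1 - \<beta>\<^sup>2))" 2]
    by (simp add: power_mult_distrib power_divide)
  let ?P = "spin_law n p"
  let ?A = "\<lambda>\<sigma>. (\<Sum>i=1..n. \<sigma> i - p i)\<^sup>2"
  let ?B = "\<lambda>\<sigma> \<tau>. \<Sum>i=1..n. \<tau> i * (\<sigma> i - p i)" and ?G = "\<lambda>\<tau>. \<Sum>i=1..n. p i * (\<tau> i - p i)"
  let ?R = "\<lambda>\<sigma> \<tau>. exp (\<beta>\<^sup>2 * ((?A \<sigma> + ?A \<tau>) / (2 * real n))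
         + (1 - \<beta>\<^sup>2) / 4 * (((?B \<sigma> \<tau>)\<^sup>2 + (?G \<tau>)\<^sup>2) / (2 * real n)))"
  define D where "D = exp (4 * l * real n * (4 * F\<^sup>2 / (1 - \<beta>\<^sup>2)\<^sup>2 + E\<^sup>2))"
  have overlap: "l * real n * (overlap n \<sigma> \<tau> - q)\<^sup>2
      \<le> (1 - \<beta>\<^sup>2) / 4 * (((?B \<sigma> \<tau>)\<^sup>2 + (?G \<tau>)\<^sup>2) / (2 * real n))
        + 4 * l * real n * (4 * F\<^sup>2 / (1 - \<beta>\<^sup>2)\<^sup>2 + E\<^sup>2)" for \<sigma> \<tau>
  proof -
    \<comment> \<open>\<open>\<sigma> i * \<tau> i - (p i)\<^sup>2\<close> is split so that each part is linear in one centred spin, given the other replica.\<close>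
    have "\<sigma> i * \<tau> i = \<tau> i * (\<sigma> i - p i) + p i * (\<tau> i - p i) + ((p i)\<^sup>2 - (r i)\<^sup>2) + (r i)\<^sup>2" for i
      by (simp add: power2_eq_square algebra_simps)
    then have "overlap n \<sigma> \<tau> - q = ?B \<sigma> \<tau> / real n + ?G \<tau> / real n + E1 + E"
      unfolding overlap_def E1_def E_def r_def[symmetric]
      by (simp only: sum.distrib add_divide_distrib)
    then have "(overlap n \<sigma> \<tau> - q)\<^sup>2
        \<le> 4 * ((?B \<sigma> \<tau> / real n)\<^sup>2 + (?G \<tau> / real n)\<^sup>2 + E1\<^sup>2 + E\<^sup>2)"
      by (simp only: square_sum4_le)
    also have "\<dots> \<le> 4 * ((?B \<sigma> \<tau> / real n)\<^sup>2 + (?G \<tau> / real n)\<^sup>2 + 4 * F\<^sup>2 / (1 - \<beta>\<^sup>2)\<^sup>2 + E\<^sup>2)"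
      using E1 by simp
    finally have "l * real n * (overlap n \<sigma> \<tau> - q)\<^sup>2 \<le> l * real n *
        (4 * ((?B \<sigma> \<tau> / real n)\<^sup>2 + (?G \<tau> / real n)\<^sup>2 + 4 * F\<^sup>2 / (1 - \<beta>\<^sup>2)\<^sup>2 + E\<^sup>2))"
      using l by (intro mult_left_mono) auto
    also have "\<dots> = 8 * l * (((?B \<sigma> \<tau>)\<^sup>2 + (?G \<tau>)\<^sup>2) / (2 * real n))
        + 4 * l * real n * (4 * F\<^sup>2 / (1 - \<beta>\<^sup>2)\<^sup>2 + E\<^sup>2)"
    proof -
      have rearrange: "l * N * (4 * ((B / N)\<^sup>2 + (G / N)\<^sup>2 + X + Y))
          = 8 * l * ((B\<^sup>2 + G\<^sup>2) / (2 * N)) + 4 * l * N * (X + Y)" if "N \<noteq> 0" for B G N X Y :: real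
        using that by (simp add: field_simps power2_eq_square)
      show ?thesis using n by (intro rearrange) simp
    qed
    also have "8 * l * (((?B \<sigma> \<tau>)\<^sup>2 + (?G \<tau>)\<^sup>2) / (2 * real n))
        \<le> (1 - \<beta>\<^sup>2) / 4 * (((?B \<sigma> \<tau>)\<^sup>2 + (?G \<tau>)\<^sup>2) / (2 * real n))"
      using l by (intro mult_right_mono) auto
    finally show ?thesis by simp
  qed
  have "gibbs_avg n \<beta> h (\<lambda>\<sigma> \<tau>. exp (l * real n * (overlap n \<sigma> \<tau> - q)\<^sup>2))
      \<le> (\<Sum>\<sigma>\<in>spins n. \<Sum>\<tau>\<in>spins n. ?P \<sigma> * ?P \<tau> * ?R \<sigma> \<tau> * D)"
    unfolding gibbs_avg_def
  proof (intro sum_mono)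
    fix \<sigma> \<tau> assume \<sigma>: "\<sigma> \<in> spins n" and \<tau>: "\<tau> \<in> spins n"
    let ?B2 = "exp ((1 - \<beta>\<^sup>2) / 4 * (((?B \<sigma> \<tau>)\<^sup>2 + (?G \<tau>)\<^sup>2) / (2 * real n)))"
    let ?W = "\<lambda>\<sigma>. exp (\<beta>\<^sup>2 * (?A \<sigma> / (2 * real n)))"
    have g: "gibbs n \<beta> h \<rho> \<le> ?P \<rho> * ?W \<rho>" if "\<rho> \<in> spins n" for \<rho>
      using n x p_def that by (rule gibbs_le_spin_law)
    have P0: "0 \<le> ?P \<rho>" if "\<rho> \<in> spins n" for \<rho>
      using p1 that by (rule spin_law_nonneg)
    have "exp (l * real n * (overlap n \<sigma> \<tau> - q)\<^sup>2) \<le> ?B2 * D"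
      using overlap[of \<sigma> \<tau>] by (simp add: D_def mult_exp_exp)
    then have "exp (l * real n * (overlap n \<sigma> \<tau> - q)\<^sup>2) * gibbs n \<beta> h \<sigma> * gibbs n \<beta> h \<tau>
        \<le> (?B2 * D) * (?P \<sigma> * ?W \<sigma>) * (?P \<tau> * ?W \<tau>)"
      using \<sigma> \<tau> by (intro mult_mono g) (auto simp: gibbs_nonneg P0 D_def)
    also have "\<dots> = ?P \<sigma> * ?P \<tau> * (?W \<sigma> * ?W \<tau> * ?B2) * D"
      by (simp only: mult_ac)
    also have "?W \<sigma> * ?W \<tau> * ?B2 = ?R \<sigma> \<tau>"
      by (simp add: exp_add add_divide_distrib distrib_left)
    finally show "exp (l * real n * (overlap n \<sigma> \<tau> - q)\<^sup>2) * gibbs n \<beta> h \<sigma> * gibbs n \<beta> h \<tau>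
        \<le> ?P \<sigma> * ?P \<tau> * ?R \<sigma> \<tau> * D" .
  qed
  also have "\<dots> = (\<Sum>\<sigma>\<in>spins n. \<Sum>\<tau>\<in>spins n. ?P \<sigma> * ?P \<tau> * ?R \<sigma> \<tau>) * D"
    by (simp only: sum_distrib_right)
  also have "\<dots> \<le> (1 / (1 - a) + 2 / sqrt (1 - a)) * D"
    unfolding a_def using p1 n b by (intro mult_right_mono two_replica_bound) (auto simp: D_def)
  finally show ?thesis
    by (simp only: D_def)
qed

text \<open>
  Convexity of \<open>exp\<close> between \<open>0\<close> and \<open>x\<close>.
\<close>
lemma exp_scale_le: "exp (\<theta> * x) \<le> 1 + \<theta> * exp x" if "0 \<le> \<theta>" "\<theta> \<le> 1" for x \<theta> :: real
proof -
  have "exp ((1 - \<theta>) *\<^sub>R 0 + \<theta> *\<^sub>R x) \<le> (1 - \<theta>) * exp 0 + \<theta> * exp x"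
    using that by (intro convex_onD[OF exp_convex]) auto
  then show ?thesis using that by simp
qed

lemma gibbs_avg_exp_scale_le:
  assumes "0 \<le> \<theta>" "\<theta> \<le> 1"
  shows "gibbs_avg n \<beta> h (\<lambda>\<sigma> \<tau>. exp (\<theta> * f \<sigma> \<tau>)) \<le> 1 + \<theta> * gibbs_avg n \<beta> h (\<lambda>\<sigma> \<tau>. exp (f \<sigma> \<tau>))"
proof -
  have "gibbs_avg n \<beta> h (\<lambda>\<sigma> \<tau>. exp (\<theta> * f \<sigma> \<tau>))
      \<le> gibbs_avg n \<beta> h (\<lambda>\<sigma> \<tau>. 1 + \<theta> * exp (f \<sigma> \<tau>))"
    unfolding gibbs_avg_def
    by (intro sum_mono mult_right_mono exp_scale_le assms gibbs_nonneg)
  also have "\<dots> = (\<Sum>\<sigma>\<in>spins n. gibbs n \<beta> h \<sigma>) * (\<Sum>\<tau>\<in>spins n. gibbs n \<beta> h \<tau>)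
      + \<theta> * gibbs_avg n \<beta> h (\<lambda>\<sigma> \<tau>. exp (f \<sigma> \<tau>))"
    unfolding gibbs_avg_def sum_product
    by (simp add: distrib_right sum.distrib sum_distrib_left mult.assoc)
  finally show ?thesis by (simp add: sum_gibbs)
qed

theorem theorem1p1:
  fixes t \<beta> m q :: real
  assumes "t \<ge> 0" and "0 < \<beta>" and "\<beta> < 1"
    and "fixed_point \<beta> t m q"
  shows "\<exists>lam>0. \<forall>n>0.
           (\<integral>h. gibbs_avg n \<beta> h (\<lambda>\<sigma> \<tau>. exp (lam * real n * (overlap n \<sigma> \<tau> - q)\<^sup>2))
              \<partial>field_dist n \<beta> t q) \<le> 2"
proof -
  define M where "M = normal_dist t (\<beta>\<^sup>2 * q + t)"
  define f where "f x = tanh (\<beta>\<^sup>2 * m + x)" for x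
  interpret N: prob_space std_normal_distribution
    by (rule prob_space_normal_density) simp
  have sets_M [measurable_cong]: "sets M = sets borel"
    by (simp add: M_def normal_dist_def)
  have M: "prob_space M"
    unfolding M_def normal_dist_def by (rule N.prob_space_distr) simp
  have "continuous_on UNIV f"
    unfolding f_def by (intro continuous_intros) auto
  then have f [measurable]: "f \<in> borel_measurable borel"
    by (rule borel_measurable_continuous_onI)
  have f1: "\<bar>f x\<bar> \<le> 1" for x
    by (simp add: f_def abs_tanh_le_one)
  have fm: "integral\<^sup>L M f = m" "(\<integral>x. (f x)\<^sup>2 \<partial>M) = q"
  proof -
    have "integral\<^sup>L M g = (\<integral>z. g (t + sqrt (\<beta>\<^sup>2 * q + t) * z) \<partial>std_normal_distribution)"
      if "g \<in> borel_measurable borel" for g :: "real \<Rightarrow> real"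
      unfolding M_def normal_dist_def using that by (intro integral_distr) auto
    moreover have "(\<lambda>x. (f x)\<^sup>2) \<in> borel_measurable borel"
      by measurable
    ultimately have "integral\<^sup>L M f = (\<integral>z. f (t + sqrt (\<beta>\<^sup>2 * q + t) * z) \<partial>std_normal_distribution)"
      "(\<integral>x. (f x)\<^sup>2 \<partial>M) = (\<integral>z. (f (t + sqrt (\<beta>\<^sup>2 * q + t) * z))\<^sup>2 \<partial>std_normal_distribution)"
      using f by blast+
    then show "integral\<^sup>L M f = m" "(\<integral>x. (f x)\<^sup>2 \<partial>M) = q"
      using assms(4) by (simp_all add: fixed_point_def f_def add.assoc)
  qed

  have b: "0 < \<beta>\<^sup>2" "\<beta>\<^sup>2 < 1"
    using assms by (auto simp: power_less_one_iff abs_square_less_1)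
  \<comment> \<open>The square cancels the \<open>(1 - \<beta>\<^sup>2)\<^sup>2\<close> that divides \<open>F\<^sup>2\<close> below; with \<open>128\<close> both field squares get a coefficient
    of at most \<open>n / 8\<close>, hence at most \<open>n / 4\<close> once they are separated.\<close>
  define l where "l = (1 - \<beta>\<^sup>2)\<^sup>2 / 128"
  have "(1 - \<beta>\<^sup>2)\<^sup>2 \<le> 1 - \<beta>\<^sup>2"
    using b power_decreasing[of 1 2 "1 - \<beta>\<^sup>2"] by simp
  then have l: "0 < l" "l \<le> (1 - \<beta>\<^sup>2) / 32"
    using b by (auto simp: l_def)
  define C1 where "C1 = 1 / (1 - (1 + \<beta>\<^sup>2) / 2) + 2 / sqrt (1 - (1 + \<beta>\<^sup>2) / 2)"
  have C1: "C1 \<ge> 1"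
  proof -
    have "1 \<le> 1 / (1 - (1 + \<beta>\<^sup>2) / 2)" "0 \<le> 2 / sqrt (1 - (1 + \<beta>\<^sup>2) / 2)"
      using b by (auto simp: field_simps)
    then show ?thesis unfolding C1_def by linarith
  qed
  \<comment> \<open>The bound of \<open>iid_mean_exp_square\<close> for \<open>a = 1 / 2\<close>, the coefficient used in \<open>e\<close> below.\<close>
  define s where "s = 1 / sqrt (1 - 1 / 2 :: real)"
  have s: "s \<ge> 1"
    by (simp add: s_def real_sqrt_divide)
  define \<theta> where "\<theta> = 1 / (C1 * (s + s))"
  have "1 \<le> C1 * (s + s)"
    using mult_mono[of 1 C1 1 "s + s"] C1 s by simp
  then have \<theta>: "0 < \<theta>" "\<theta> \<le> 1" "\<theta> * (C1 * (s + s)) = 1"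
    by (auto simp: \<theta>_def divide_le_eq)

  have "(\<integral>h. gibbs_avg n \<beta> h (\<lambda>\<sigma> \<tau>. exp (\<theta> * l * real n * (overlap n \<sigma> \<tau> - q)\<^sup>2))
      \<partial>field_dist n \<beta> t q) \<le> 2" if n: "0 < n" for n
  proof (rule integral_real_bounded)
    let ?P = "Pi\<^sub>M {1..n} (\<lambda>_. M)"
    define e where "e g c h = exp (1 / 2 * real n * ((\<Sum>i=1..n. g (h i)) / real n - c)\<^sup>2 / 2)"
      for g :: "real \<Rightarrow> real" and c :: real and h :: "nat \<Rightarrow> real"
    have [measurable]: "(\<lambda>h. e g c h) \<in> borel_measurable ?P" if "g \<in> borel_measurable borel" for g c
      unfolding e_def using that by measurable
    have conc: "(\<integral>\<^sup>+h. ennreal (e g (integral\<^sup>L M g) h) \<partial>?P) \<le> ennreal s"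
      if [measurable]: "g \<in> borel_measurable borel" and "\<And>x. \<bar>g x\<bar> \<le> 1" for g
      unfolding e_def s_def using that n by (intro iid_mean_exp_square M) auto
    have bound: "gibbs_avg n \<beta> h (\<lambda>\<sigma> \<tau>. exp (\<theta> * l * real n * (overlap n \<sigma> \<tau> - q)\<^sup>2))
        \<le> 1 + \<theta> * C1 * (e f m h + e (\<lambda>x. (f x)\<^sup>2) q h)" for h
    proof -
      define F where "F = (\<Sum>i=1..n. tanh (\<beta>\<^sup>2 * m + h i)) / real n - m"
      define E where "E = (\<Sum>i=1..n. (tanh (\<beta>\<^sup>2 * m + h i))\<^sup>2) / real n - q"
      have "gibbs_avg n \<beta> h (\<lambda>\<sigma> \<tau>. exp (l * real n * (overlap n \<sigma> \<tau> - q)\<^sup>2))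
          \<le> C1 * exp (4 * l * real n * (4 * F\<^sup>2 / (1 - \<beta>\<^sup>2)\<^sup>2 + E\<^sup>2))"
        unfolding C1_def F_def E_def using n b l by (intro overlap_bound_given_field) auto
      also have "\<dots> \<le> C1 * (exp (real n * F\<^sup>2 / 4) + exp (real n * E\<^sup>2 / 4))"
      proof (intro mult_left_mono)
        have F8: "4 * l * real n * (4 * F\<^sup>2 / (1 - \<beta>\<^sup>2)\<^sup>2) = real n * F\<^sup>2 / 8"
          using b by (simp add: l_def)
        have E8: "4 * l * real n * E\<^sup>2 \<le> real n * E\<^sup>2 / 8"
        proof -
          have "l \<le> 1 / 32" by (rule order.trans[OF l(2)]) simp
          from mult_right_mono[OF this, of "4 * real n * E\<^sup>2"] show ?thesis by simp
        qed
        have "4 * l * real n * (4 * F\<^sup>2 / (1 - \<beta>\<^sup>2)\<^sup>2 + E\<^sup>2) \<le> real n * F\<^sup>2 / 8 + real n * E\<^sup>2 / 8"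
          unfolding distrib_left by (intro add_mono eq_refl[OF F8] E8)
        also have "\<dots> \<le> max (real n * F\<^sup>2 / 4) (real n * E\<^sup>2 / 4)"
          by (auto simp: max_def)
        finally have "4 * l * real n * (4 * F\<^sup>2 / (1 - \<beta>\<^sup>2)\<^sup>2 + E\<^sup>2)
            \<le> max (real n * F\<^sup>2 / 4) (real n * E\<^sup>2 / 4)" .
        then have "exp (4 * l * real n * (4 * F\<^sup>2 / (1 - \<beta>\<^sup>2)\<^sup>2 + E\<^sup>2))
            \<le> exp (max (real n * F\<^sup>2 / 4) (real n * E\<^sup>2 / 4))"
          by simp
        also have "\<dots> \<le> exp (real n * F\<^sup>2 / 4) + exp (real n * E\<^sup>2 / 4)"
          by (simp add: max_def)
        finally show "exp (4 * l * real n * (4 * F\<^sup>2 / (1 - \<beta>\<^sup>2)\<^sup>2 + E\<^sup>2))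
            \<le> exp (real n * F\<^sup>2 / 4) + exp (real n * E\<^sup>2 / 4)" .
      qed (use C1 in simp)
      also have "\<dots> = C1 * (e f m h + e (\<lambda>x. (f x)\<^sup>2) q h)"
        by (simp add: e_def F_def E_def f_def)
      finally have *: "gibbs_avg n \<beta> h (\<lambda>\<sigma> \<tau>. exp (l * real n * (overlap n \<sigma> \<tau> - q)\<^sup>2))
          \<le> C1 * (e f m h + e (\<lambda>x. (f x)\<^sup>2) q h)" .
      have "gibbs_avg n \<beta> h (\<lambda>\<sigma> \<tau>. exp (\<theta> * (l * real n * (overlap n \<sigma> \<tau> - q)\<^sup>2)))
          \<le> 1 + \<theta> * gibbs_avg n \<beta> h (\<lambda>\<sigma> \<tau>. exp (l * real n * (overlap n \<sigma> \<tau> - q)\<^sup>2))"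
        using \<theta> by (intro gibbs_avg_exp_scale_le) auto
      also have "\<dots> \<le> 1 + \<theta> * (C1 * (e f m h + e (\<lambda>x. (f x)\<^sup>2) q h))"
        using \<theta>(1) by (intro add_left_mono mult_left_mono *) simp
      finally show ?thesis
        by (simp only: mult.assoc)
    qed
    have f2: "\<bar>(f x)\<^sup>2\<bar> \<le> 1" for x
      using f1[of x] by (simp add: abs_square_le_1)
    interpret P: prob_space ?P
      by (intro prob_space_PiM M)
    \<comment> \<open>Keeps the index set \<open>{1..n}\<close> in the form in which the measurability facts are stated.\<close>
    note One_nat_def [simp del]
    have "(\<integral>\<^sup>+h. ennreal (gibbs_avg n \<beta> h (\<lambda>\<sigma> \<tau>. exp (\<theta> * l * real n * (overlap n \<sigma> \<tau> - q)\<^sup>2))) \<partial>?P)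
        \<le> (\<integral>\<^sup>+h. 1 + ennreal (\<theta> * C1) * (ennreal (e f m h) + ennreal (e (\<lambda>x. (f x)\<^sup>2) q h)) \<partial>?P)"
    proof (intro nn_integral_mono)
      fix h
      have "0 \<le> e f m h" "0 \<le> e (\<lambda>x. (f x)\<^sup>2) q h" by (auto simp: e_def)
      then show "ennreal (gibbs_avg n \<beta> h (\<lambda>\<sigma> \<tau>. exp (\<theta> * l * real n * (overlap n \<sigma> \<tau> - q)\<^sup>2)))
          \<le> 1 + ennreal (\<theta> * C1) * (ennreal (e f m h) + ennreal (e (\<lambda>x. (f x)\<^sup>2) q h))"
        using bound[of h] \<theta> C1
        by (simp add: ennreal_leI flip: ennreal_plus ennreal_mult ennreal_1)
    qed
    also have "\<dots> = 1 + ennreal (\<theta> * C1) *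
        ((\<integral>\<^sup>+h. ennreal (e f m h) \<partial>?P) + (\<integral>\<^sup>+h. ennreal (e (\<lambda>x. (f x)\<^sup>2) q h) \<partial>?P))"
      by (simp add: nn_integral_add nn_integral_cmult P.emeasure_space_1)
    also have "\<dots> \<le> 1 + ennreal (\<theta> * C1) * (ennreal s + ennreal s)"
      using conc[OF f f1] conc[of "\<lambda>x. (f x)\<^sup>2"] f2
      by (intro add_mono mult_left_mono) (auto simp: fm)
    also have "\<dots> = ennreal (1 + \<theta> * (C1 * (s + s)))"
      using \<theta>(1) C1 s by (simp add: mult.assoc flip: ennreal_plus ennreal_mult ennreal_1)
    also have "\<dots> = ennreal 2"
      by (simp only: \<theta>(3)) simp
    finally show "(\<integral>\<^sup>+h. ennreal (gibbs_avg n \<beta> h (\<lambda>\<sigma> \<tau>. exp (\<theta> * l * real n * (overlap n \<sigma> \<tau> - q)\<^sup>2)))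
        \<partial>field_dist n \<beta> t q) \<le> ennreal 2"
      by (simp only: field_dist_def M_def)
  qed simp
  then show ?thesis
    using \<theta>(1) l(1) by (intro exI[of _ "\<theta> * l"]) auto
qed

end
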